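(* Let $X\in\mathbb{R}^{n\times p}$ have columns in general position, $y\in\mathbb{R}^n$, $\lambda_{\mathrm L}>0$, and suppose the Lasso equicorrelation set $E$ is nonempty, with equicorrelation sign vector $s$. Let $q\ge0$ be an integer and $A\in\mathbb{R}^{q\times|E|}$, and define $$H_{E,s}(A)=2\lambda_{\mathrm L}\langle\hat\delta_{A,E},s\rangle-\frac1n\langle X_E\hat\delta_{A,E},X_E\hat\delta_{A,E}\rangle .$$ If $A^\top A\succeq0$, then $H_{E,s}(A)>0$. If, in addition, there exists $\tau\ge0$ such that $$0\preceq A^\top A\preceq\tau\Sigma_{n,E},$$ then $$H_{E,s}(A)\ge\lambda_{\mathrm L}^2|E|\,\frac{1+2\tau}{(1+\tau)^2}\,\frac1{\|\Sigma_{n,E}\|_2}>0 .$$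
   Context: Notation: $X_S$ is the submatrix of columns of $X$ indexed by $S\subseteq\{1,\dots,p\}$; $v_S$, $v_{-S}$ are the subvectors of $v$ indexed by $S$ and its complement; $\|B\|_2$ is the operator norm; $\preceq$ is the Loewner order on symmetric matrices. General position: for every integer $0\le k<\min\{n,p\}$, no $k$-dimensional affine subspace of $\mathbb{R}^n$ contains more than $k+1$ elements of $\{\pm X_1,\dots,\pm X_p\}$, excluding antipodal pairs (i.e. for any distinct indices $i_1,\dots,i_{k+2}$ and any signs $\sigma_1,\dots,\sigma_{k+2}\in\{\pm1\}$, the vectors $\sigma_1X_{i_1},\dots,\sigma_{k+2}X_{i_{k+2}}$ do not all lie in a $k$-dimensional affine subspace). Under general position the Lasso minimizer below is unique and $X_E$ has full column rank. Lasso: $\hat\beta_{\mathrm L}=\arg\min_{\beta\in\mathbb{R}^p}\{\frac1{2n}\|y-X\beta\|_2^2+\lambda_{\mathrm L}\|\beta\|_1\}$. Equicorrelation set: $E=\{j:|\frac1nX_j^\top(y-X\hat\beta_{\mathrm L})|=\lambda_{\mathrm L}\}$. Sign vector: $s=\operatorname{sign}(X_E^\top(y-X\hat\beta_{\mathrm L}))\in\{-1,1\}^{|E|}$. Restricted Gram matrix: $\Sigma_{n,E}=\frac1nX_E^\top X_E$. Generalized correction: $\hat\delta_A$ is the minimizer over $\delta\in\mathbb{R}^p$ with $\delta_{-E}=0$ of $\frac1{2n}\|y-X\hat\beta_{\mathrm L}-X\delta\|_2^2+\frac12\|A\delta_E\|_2^2$, and $\hat\delta_{A,E}$ is its restriction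 to $E$. *)

theory Defs
  imports "HOL-Analysis.Analysis"
begin

text \<open>
  The design matrix is \<open>X :: real ^ 'p ^ 'n\<close>, so its columns are indexed by \<open>'p\<close> and live in
  \<open>real ^ 'n\<close>.

  The set \<open>E\<close> depends on the data, and the number \<open>q\<close> of rows of \<open>A\<close> may be zero, so neither can
  be a type.  Matrices and vectors with such dimensions are functions together with explicit
  finite index sets; values outside the index sets are irrelevant.  In particular the columns of
  \<open>X\<^sub>E\<close> and \<open>A\<close>, the entries of \<open>s\<close>, and the rows and columns of the restricted Gram matrix are
  indexed by the elements of \<open>E\<close> itself rather than by \<open>1, \<dots>, |E|\<close>.
\<close>

definition matvec_on :: "'j set \<Rightarrow> ('i \<Rightarrow> 'j \<Rightarrow> real) \<Rightarrow> ('j \<Rightarrow> real) \<Rightarrow> 'i \<Rightarrow> real"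
  where "matvec_on J M v = (\<lambda>i. \<Sum>j\<in>J. M i j * v j)"

definition gram_on :: "'i set \<Rightarrow> ('i \<Rightarrow> 'j \<Rightarrow> real) \<Rightarrow> 'j \<Rightarrow> 'j \<Rightarrow> real"
  \<comment> \<open>\<open>M\<^sup>T M\<close> for a matrix with rows indexed by \<open>I\<close>\<close>
  where "gram_on I M = (\<lambda>j k. \<Sum>i\<in>I. M i j * M i k)"

definition op_norm_on :: "'i set \<Rightarrow> 'j set \<Rightarrow> ('i \<Rightarrow> 'j \<Rightarrow> real) \<Rightarrow> real"
  \<comment> \<open>the definition of \<^const>\<open>onorm\<close>, for Euclidean norms over index sets\<close>
  where "op_norm_on I J M = (SUP v. L2_set (matvec_on J M v) I / L2_set v J)"

lemma op_norm_on_UNIV: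
  fixes M :: "real ^ 'm ^ 'k"
  shows "op_norm_on UNIV UNIV (\<lambda>i j. M $ i $ j) = onorm ((*v) M)"
proof -
  have "range (\<lambda>v :: 'm \<Rightarrow> real. L2_set (matvec_on UNIV (\<lambda>i j. M $ i $ j) v) UNIV / L2_set v UNIV)
      = range (\<lambda>x. norm (M *v x) / norm x)"
  proof (intro equalityI subsetI)
    fix t
    assume "t \<in> range (\<lambda>v :: 'm \<Rightarrow> real.
      L2_set (matvec_on UNIV (\<lambda>i j. M $ i $ j) v) UNIV / L2_set v UNIV)"
    then obtain v :: "'m \<Rightarrow> real"
      where "t = L2_set (matvec_on UNIV (\<lambda>i j. M $ i $ j) v) UNIV / L2_set v UNIV" by blast
    then have "t = norm (M *v (\<chi> j. v j)) / norm (\<chi> j. v j)"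
      by (simp add: norm_vec_def matvec_on_def matrix_vector_mult_def L2_set_def)
    then show "t \<in> range (\<lambda>x. norm (M *v x) / norm x)" by blast
  next
    fix t
    assume "t \<in> range (\<lambda>x. norm (M *v x) / norm x)"
    then obtain x where "t = norm (M *v x) / norm x" by blast
    then have "t = L2_set (matvec_on UNIV (\<lambda>i j. M $ i $ j) (($) x)) UNIV / L2_set (($) x) UNIV"
      by (simp add: norm_vec_def matvec_on_def matrix_vector_mult_def L2_set_def)
    then show "t \<in> range (\<lambda>v :: 'm \<Rightarrow> real.
      L2_set (matvec_on UNIV (\<lambda>i j. M $ i $ j) v) UNIV / L2_set v UNIV)" by blast
  qed
  then show ?thesis
    by (simp add: op_norm_on_def onorm_def)
qed

definition symmetric_on :: "'i set \<Rightarrow> ('i \<Rightarrow> 'i \<Rightarrow> real) \<Rightarrow> bool"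
  where "symmetric_on I M \<longleftrightarrow> (\<forall>i\<in>I. \<forall>j\<in>I. M i j = M j i)"

definition loewner_le_on :: "'i set \<Rightarrow> ('i \<Rightarrow> 'i \<Rightarrow> real) \<Rightarrow> ('i \<Rightarrow> 'i \<Rightarrow> real) \<Rightarrow> bool"
  where "loewner_le_on I M N \<longleftrightarrow> symmetric_on I M \<and> symmetric_on I N \<and>
    (\<forall>v. 0 \<le> (\<Sum>i\<in>I. v i * matvec_on I (\<lambda>i j. N i j - M i j) v i))"

definition general_position :: "real ^ 'p ^ 'n \<Rightarrow> bool"
  \<comment> \<open>The \<open>k + 2\<close> distinct indices are the elements of \<open>I\<close>, which excludes antipodal pairs.\<close>
  where "general_position X \<longleftrightarrow>
    (\<forall>k < min CARD('n) CARD('p). \<forall>L :: (real ^ 'n) set.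
      affine L \<and> aff_dim L = int k \<longrightarrow>
      \<not> (\<exists>I \<sigma>. card I = k + 2 \<and> (\<forall>i\<in>I. \<sigma> i \<in> {-1, 1 :: real} \<and> \<sigma> i *\<^sub>R column i X \<in> L)))"

definition lasso_objective :: "real ^ 'p ^ 'n \<Rightarrow> real ^ 'n \<Rightarrow> real \<Rightarrow> real ^ 'p \<Rightarrow> real"
  where "lasso_objective X y lam b =
    1 / (2 * real CARD('n)) * (norm (y - X *v b))\<^sup>2 + lam * (\<Sum>j\<in>UNIV. \<bar>b $ j\<bar>)"

definition lasso :: "real ^ 'p ^ 'n \<Rightarrow> real ^ 'n \<Rightarrow> real \<Rightarrow> real ^ 'p"
  where "lasso X y lam = arg_min (lasso_objective X y lam) (\<lambda>_. True)"

definition lasso_residual :: "real ^ 'p ^ 'n \<Rightarrow> real ^ 'n \<Rightarrow> real \<Rightarrow> real ^ 'n"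
  where "lasso_residual X y lam = y - X *v lasso X y lam"

definition equicorrelation_set :: "real ^ 'p ^ 'n \<Rightarrow> real ^ 'n \<Rightarrow> real \<Rightarrow> 'p set"
  where "equicorrelation_set X y lam =
    {j. \<bar>1 / real CARD('n) * (column j X \<bullet> lasso_residual X y lam)\<bar> = lam}"

definition equicorrelation_signs :: "real ^ 'p ^ 'n \<Rightarrow> real ^ 'n \<Rightarrow> real \<Rightarrow> 'p \<Rightarrow> real"
  where "equicorrelation_signs X y lam = (\<lambda>j. sgn (column j X \<bullet> lasso_residual X y lam))"

definition restricted_gram :: "real ^ 'p ^ 'n \<Rightarrow> 'p \<Rightarrow> 'p \<Rightarrow> real"
  \<comment> \<open>to be used with rows and columns in \<open>E\<close>\<close>
  where "restricted_gram X = (\<lambda>j k. 1 / real CARD('n) * gram_on UNIV (\<lambda>i j. X $ i $ j) j k)"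

definition correction_objective ::
    "real ^ 'p ^ 'n \<Rightarrow> real ^ 'n \<Rightarrow> real \<Rightarrow> nat \<Rightarrow> (nat \<Rightarrow> 'p \<Rightarrow> real) \<Rightarrow> real ^ 'p \<Rightarrow> real"
  where "correction_objective X y lam q A d =
    1 / (2 * real CARD('n)) * (norm (y - X *v lasso X y lam - X *v d))\<^sup>2 +
    1 / 2 * (L2_set (matvec_on (equicorrelation_set X y lam) A (($) d)) {..<q})\<^sup>2"

definition correction ::
    "real ^ 'p ^ 'n \<Rightarrow> real ^ 'n \<Rightarrow> real \<Rightarrow> nat \<Rightarrow> (nat \<Rightarrow> 'p \<Rightarrow> real) \<Rightarrow> real ^ 'p"
  where "correction X y lam q A =
    arg_min (correction_objective X y lam q A)
      (\<lambda>d. \<forall>j. j \<notin> equicorrelation_set X y lam \<longrightarrow> d $ j = 0)"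

definition H_val ::
    "real ^ 'p ^ 'n \<Rightarrow> real ^ 'n \<Rightarrow> real \<Rightarrow> nat \<Rightarrow> (nat \<Rightarrow> 'p \<Rightarrow> real) \<Rightarrow> real"
  where "H_val X y lam q A =
    (let E = equicorrelation_set X y lam;
         s = equicorrelation_signs X y lam;
         d = correction X y lam q A;
         XEd = matvec_on E (\<lambda>i j. X $ i $ j) (($) d)
     in 2 * lam * (\<Sum>j\<in>E. d $ j * s j) - 1 / real CARD('n) * (\<Sum>i\<in>UNIV. XEd i * XEd i))"

end

theory Submission
  imports Defs
begin

text \<open>
  Write \<open>\<Sigma>\<close> for the restricted Gram matrix, \<open>B = A\<^sup>T A\<close>, \<open>d\<close> for the correction and
  \<open>g = X\<^sub>E\<^sup>T r / n\<close> for the Lasso residual \<open>r\<close>.  By definition of the equicorrelation set,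
  \<open>g = \<lambda>s\<close>, and the normal equation \<open>(\<Sigma> + B) d = g\<close> gives \<open>H = \<langle>d, \<Sigma>d\<rangle> + 2\<langle>d, Bd\<rangle>\<close>.  If this
  vanished, so would \<open>\<Sigma>d\<close> and \<open>Bd\<close>, contradicting \<open>g \<noteq> 0\<close>.  For the quantitative bound, put
  \<open>N = \<parallel>\<Sigma>\<parallel>\<close> and add the inequalities \<open>\<langle>e, (\<tau>\<Sigma> - B) e\<rangle> \<ge> 0\<close> for \<open>e = g - N d\<close> and
  \<open>\<langle>e, B e\<rangle> \<ge> 0\<close> for \<open>e = g - N (1 + \<tau>) d\<close>; then \<open>\<langle>g, \<Sigma>g\<rangle> \<le> N |g|\<^sup>2\<close> and
  \<open>\<langle>d, (\<Sigma> + B) g\<rangle> = |g|\<^sup>2\<close> yield the claim without inverting \<open>\<Sigma>\<close>.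
\<close>

section \<open>Bilinear forms \<open>u^T K v\<close> and Gram matrices over index sets\<close>

definition qform_on :: "'i set \<Rightarrow> ('i \<Rightarrow> 'i \<Rightarrow> real) \<Rightarrow> ('i \<Rightarrow> real) \<Rightarrow> ('i \<Rightarrow> real) \<Rightarrow> real"
  where "qform_on I K u v = (\<Sum>i\<in>I. u i * matvec_on I K v i)"

lemma qform_on_add_right: "qform_on I K u (\<lambda>i. v i + w i) = qform_on I K u v + qform_on I K u w"
  by (simp add: qform_on_def matvec_on_def sum.distrib distrib_left)

lemma qform_on_scale_right: "qform_on I K u (\<lambda>i. c * v i) = c * qform_on I K u v"
  by (simp add: qform_on_def matvec_on_def sum_distrib_left mult_ac)

lemma qform_on_add_left: "qform_on I K (\<lambda>i. u i + w i) v = qform_on I K u v + qform_on I K w v"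
  by (simp add: qform_on_def sum.distrib distrib_right)

lemma qform_on_scale_left: "qform_on I K (\<lambda>i. c * u i) v = c * qform_on I K u v"
  by (simp add: qform_on_def sum_distrib_left mult_ac)

lemma qform_on_add_matrix:
  "qform_on I (\<lambda>i j. K i j + L i j) u v = qform_on I K u v + qform_on I L u v"
  by (simp add: qform_on_def matvec_on_def sum.distrib distrib_left distrib_right)

lemma qform_on_diff_matrix:
  "qform_on I (\<lambda>i j. K i j - L i j) u v = qform_on I K u v - qform_on I L u v"
  by (simp add: qform_on_def matvec_on_def sum_subtractf left_diff_distrib right_diff_distrib)

lemma qform_on_scale_matrix: "qform_on I (\<lambda>i j. c * K i j) u v = c * qform_on I K u v"
  by (simp add: qform_on_def matvec_on_def sum_distrib_left mult_ac)

lemma qform_on_zero_matrix [simp]: "qform_on I (\<lambda>_ _. 0) u v = 0"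
  by (simp add: qform_on_def matvec_on_def)

lemma qform_on_commute:
  assumes "symmetric_on I K"
  shows "qform_on I K u v = qform_on I K v u"
proof -
  have "qform_on I K u v = (\<Sum>i\<in>I. \<Sum>j\<in>I. u i * K i j * v j)"
    by (simp add: qform_on_def matvec_on_def sum_distrib_left mult_ac)
  also have "\<dots> = (\<Sum>j\<in>I. \<Sum>i\<in>I. u i * K i j * v j)"
    by (rule sum.swap)
  also have "\<dots> = (\<Sum>j\<in>I. \<Sum>i\<in>I. v j * K j i * u i)"
    using assms by (intro sum.cong refl) (auto simp: symmetric_on_def)
  also have "\<dots> = qform_on I K v u"
    by (simp add: qform_on_def matvec_on_def sum_distrib_left mult_ac)
  finally show ?thesis .
qed

lemma qform_on_cong:
  assumes "\<And>i. i \<in> I \<Longrightarrow> u i = u' i" "\<And>i. i \<in> I \<Longrightarrow> v i = v' i"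
  shows "qform_on I K u v = qform_on I K u' v'"
  using assms by (simp add: qform_on_def matvec_on_def)

lemma loewner_le_on_iff_qform_on:
  "loewner_le_on I K L \<longleftrightarrow> symmetric_on I K \<and> symmetric_on I L \<and>
    (\<forall>v. qform_on I K v v \<le> qform_on I L v v)"
  by (simp add: loewner_le_on_def qform_on_diff_matrix flip: qform_on_def)

lemma symmetric_on_gram_on: "symmetric_on J (gram_on I M)"
  by (simp add: symmetric_on_def gram_on_def mult.commute)

lemma sum_matvec_on_mult_eq_qform_on_gram_on:
  "(\<Sum>i\<in>I. matvec_on J M u i * matvec_on J M v i) = qform_on J (gram_on I M) u v"
proof -
  have "(\<Sum>i\<in>I. matvec_on J M u i * matvec_on J M v i) =
      (\<Sum>i\<in>I. \<Sum>j\<in>J. \<Sum>k\<in>J. u j * (M i j * M i k * v k))"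
    by (simp add: matvec_on_def sum_product mult_ac)
  also have "\<dots> = (\<Sum>j\<in>J. \<Sum>i\<in>I. \<Sum>k\<in>J. u j * (M i j * M i k * v k))"
    by (rule sum.swap)
  also have "\<dots> = (\<Sum>j\<in>J. \<Sum>k\<in>J. \<Sum>i\<in>I. u j * (M i j * M i k * v k))"
    by (intro sum.cong refl) (rule sum.swap)
  also have "\<dots> = qform_on J (gram_on I M) u v"
    by (simp add: qform_on_def matvec_on_def gram_on_def sum_distrib_left sum_distrib_right)
  finally show ?thesis .
qed

lemma qform_on_gram_on_nonneg: "0 \<le> qform_on J (gram_on I M) v v"
  by (auto simp flip: sum_matvec_on_mult_eq_qform_on_gram_on intro: sum_nonneg)

text \<open>This is Cauchy-Schwarz for the images of \<open>u\<close> and \<open>v\<close> under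
  \<open>M\<close>, so the form may be degenerate. It later makes a mixed term vanish as soon as one
  diagonal term does.\<close>

lemma qform_on_gram_on_Cauchy_Schwarz:
  "(qform_on J (gram_on I M) u v)\<^sup>2 \<le> qform_on J (gram_on I M) u u * qform_on J (gram_on I M) v v"
  using Cauchy_Schwarz_ineq_sum[of "matvec_on J M u" "matvec_on J M v" I]
  by (simp add: power2_eq_square sum_matvec_on_mult_eq_qform_on_gram_on)

section \<open>Bounds by the operator norm\<close>

lemma L2_set_matvec_on_le_op_norm_on:
  assumes "finite I" "finite J"
  shows "L2_set (matvec_on J M v) I \<le> op_norm_on I J M * L2_set v J"
proof -
  \<comment> \<open>A crude constant is enough: it shows that the supremum in
    \<open>op_norm_on\<close> is over a bounded set and settles vectors of norm zero.\<close>
  define C where "C = (\<Sum>i\<in>I. \<Sum>j\<in>J. \<bar>M i j\<bar>)"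
  have bound: "L2_set (matvec_on J M w) I \<le> C * L2_set w J" for w
  proof -
    have "L2_set (matvec_on J M w) I \<le> (\<Sum>i\<in>I. \<bar>matvec_on J M w i\<bar>)"
      by (rule L2_set_le_sum_abs)
    also have "\<dots> \<le> (\<Sum>i\<in>I. \<Sum>j\<in>J. \<bar>M i j\<bar> * L2_set w J)"
    proof (rule sum_mono)
      fix i
      have "\<bar>matvec_on J M w i\<bar> \<le> (\<Sum>j\<in>J. \<bar>M i j * w j\<bar>)"
        unfolding matvec_on_def by (rule sum_abs)
      also have "\<dots> \<le> (\<Sum>j\<in>J. \<bar>M i j\<bar> * L2_set w J)"
      proof (rule sum_mono)
        fix j assume "j \<in> J"
        then have "\<bar>w j\<bar> \<le> L2_set (\<lambda>j. \<bar>w j\<bar>) J"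
          using assms by (intro member_le_L2_set) auto
        then show "\<bar>M i j * w j\<bar> \<le> \<bar>M i j\<bar> * L2_set w J"
          by (simp add: abs_mult L2_set_def mult_left_mono)
      qed
      finally show "\<bar>matvec_on J M w i\<bar> \<le> (\<Sum>j\<in>J. \<bar>M i j\<bar> * L2_set w J)" .
    qed
    also have "\<dots> = C * L2_set w J"
      by (simp add: C_def sum_distrib_right)
    finally show ?thesis .
  qed
  have "C \<ge> 0"
    by (simp add: C_def sum_nonneg)
  \<comment> \<open>The supremum also ranges over vectors of norm zero; their quotient is
    \<open>0\<close> by the convention for division, and \<open>C \<ge> 0\<close> covers
    them.\<close>
  then have "L2_set (matvec_on J M w) I / L2_set w J \<le> C" for w
    using bound[of w] L2_set_nonneg[of w J]
    by (cases "L2_set w J = 0") (auto simp: divide_le_eq less_le)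
  then have "bdd_above (range (\<lambda>w. L2_set (matvec_on J M w) I / L2_set w J))"
    by (intro bdd_aboveI[where M = C]) auto
  then have "L2_set (matvec_on J M v) I / L2_set v J \<le> op_norm_on I J M"
    unfolding op_norm_on_def by (rule cSUP_upper2[OF _ UNIV_I order_refl])
  moreover have "L2_set (matvec_on J M v) I = 0" if "L2_set v J = 0"
    using bound[of v] that L2_set_nonneg[of "matvec_on J M v" I] by simp
  ultimately show ?thesis
    using L2_set_nonneg[of v J]
    by (cases "L2_set v J = 0") (auto simp: divide_le_eq less_le split: if_splits)
qed

lemma qform_on_le_op_norm_on:
  assumes "finite I"
  shows "qform_on I K v v \<le> op_norm_on I I K * (\<Sum>i\<in>I. (v i)\<^sup>2)"
proof -
  have "qform_on I K v v \<le> (\<Sum>i\<in>I. \<bar>v i\<bar> * \<bar>matvec_on I K v i\<bar>)"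
    unfolding qform_on_def by (intro sum_mono) (metis abs_ge_self abs_mult)
  also have "\<dots> \<le> L2_set v I * L2_set (matvec_on I K v) I"
    by (rule L2_set_mult_ineq)
  also have "\<dots> \<le> L2_set v I * (op_norm_on I I K * L2_set v I)"
    by (intro mult_left_mono L2_set_matvec_on_le_op_norm_on assms L2_set_nonneg)
  also have "\<dots> = op_norm_on I I K * (L2_set v I)\<^sup>2"
    by (simp add: power2_eq_square)
  finally show ?thesis
    by (simp add: L2_set_def sum_nonneg)
qed

section \<open>The lower bound for abstract quadratic forms\<close>

lemma psd_on_square_expand:
  assumes "symmetric_on I K" and "\<And>v. 0 \<le> qform_on I K v v"
  shows "0 \<le> qform_on I K g g - 2 * c * qform_on I K d g + c\<^sup>2 * qform_on I K d d"
proof -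
  have "0 \<le> qform_on I K (\<lambda>i. g i + (- c) * d i) (\<lambda>i. g i + (- c) * d i)"
    by (rule assms)
  also have "\<dots> = qform_on I K g g - 2 * c * qform_on I K d g + c\<^sup>2 * qform_on I K d d"
    unfolding qform_on_add_left qform_on_add_right qform_on_scale_left qform_on_scale_right
    using qform_on_commute[OF assms(1), of g d] by (simp add: power2_eq_square algebra_simps)
  finally show ?thesis .
qed

text \<open>The factor comes from the extremal case where \<open>S\<close> is \<open>N\<close> times
  the identity and \<open>B = \<tau> S\<close>: then \<open>d = g / (N (1 + \<tau>))\<close> and
  equality holds. The equation \<open>(S + B) d = g\<close> enters only in weak form.\<close>

lemma quadratic_solution_lower_bound:
  fixes S :: "'i \<Rightarrow> 'i \<Rightarrow> real" and d g :: "'i \<Rightarrow> real" and \<tau> N :: real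
    and R :: "'r set" and A :: "'r \<Rightarrow> 'i \<Rightarrow> real"
  defines "B \<equiv> gram_on R A"
  assumes S: "loewner_le_on I (\<lambda>_ _. 0) S"
    and BS: "loewner_le_on I B (\<lambda>i j. \<tau> * S i j)"
    and solution: "\<And>v. qform_on I S d v + qform_on I B d v = (\<Sum>i\<in>I. g i * v i)"
    and N: "qform_on I S g g \<le> N * (\<Sum>i\<in>I. (g i)\<^sup>2)" "N > 0"
    and \<tau>: "\<tau> \<ge> 0"
  shows "(1 + 2 * \<tau>) * (\<Sum>i\<in>I. (g i)\<^sup>2) \<le>
    (1 + \<tau>)\<^sup>2 * N * (qform_on I S d d + 2 * qform_on I B d d)"
proof -
  have symS: "symmetric_on I S" and symB: "symmetric_on I B"
    using S BS by (simp_all add: loewner_le_on_iff_qform_on)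
  have S_nonneg: "0 \<le> qform_on I S v v" for v
    using S by (simp add: loewner_le_on_iff_qform_on)
  have B_le: "qform_on I B v v \<le> \<tau> * qform_on I S v v" for v
    using BS by (simp add: loewner_le_on_iff_qform_on qform_on_scale_matrix)
  have B_nonneg: "0 \<le> qform_on I B v v" for v
    unfolding B_def by (rule qform_on_gram_on_nonneg)
  have G: "qform_on I S d g + qform_on I B d g = (\<Sum>i\<in>I. (g i)\<^sup>2)"
    using solution[of g] by (simp add: power2_eq_square)
  define p u w where "p = qform_on I S d d" and "u = qform_on I S d g" and "w = qform_on I S g g"
  define p' u' w' where "p' = qform_on I B d d" and "u' = qform_on I B d g" and "w' = qform_on I B g g"
  define G where "G = (\<Sum>i\<in>I. (g i)\<^sup>2)"
  have GN: "w \<le> N * G" "u + u' = G"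
    using N G by (simp_all add: w_def u_def u'_def G_def)
  have pos: "0 \<le> p" "0 \<le> p'" "p' \<le> \<tau> * p"
    using S_nonneg B_nonneg B_le by (simp_all add: p_def p'_def)
  have "(1 + 2 * \<tau>) * G \<le> (1 + \<tau>)\<^sup>2 * N * (p + 2 * p')"
  \<comment> \<open>The other case ends by cancelling a factor \<tau>. For \<tau> = 0 the form of
    \<open>B\<close> vanishes on the diagonal, and Cauchy-Schwarz removes the mixed term
    \<open>u'\<close> as well.\<close>
  proof (cases "\<tau> = 0")
    case True
    then have "w' = 0"
      using B_le[of g] B_nonneg[of g] by (simp add: w'_def)
    then have "u' = 0"
      using qform_on_gram_on_Cauchy_Schwarz[of I R A d g] by (simp add: B_def u'_def w'_def)
    moreover have "0 \<le> w - 2 * N * u + N\<^sup>2 * p"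
      unfolding p_def u_def w_def by (rule psd_on_square_expand[OF symS S_nonneg])
    ultimately have "N * G \<le> N * (N * p)"
      using GN by (simp add: power2_eq_square algebra_simps)
    then have "G \<le> N * p"
      using \<open>N > 0\<close> by simp
    also have "\<dots> \<le> N * (p + 2 * p')"
      using pos \<open>N > 0\<close> by simp
    finally show ?thesis
      using True by simp
  next
    case False
    \<comment> \<open>The form to be shown nonnegative is affine in \<open>B\<close>, so it interpolates between its values
      at \<open>B = 0\<close> and \<open>B = \<tau>S\<close>, which are paired with \<open>\<tau>S - B\<close> and \<open>B\<close>.\<close>
    let ?D = "\<lambda>i j. \<tau> * S i j - B i j"
    have D: "qform_on I ?D a b = \<tau> * qform_on I S a b - qform_on I B a b" for a b
      by (simp add: qform_on_diff_matrix qform_on_scale_matrix)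
    have "symmetric_on I ?D"
      using symS symB by (simp add: symmetric_on_def)
    moreover have "0 \<le> qform_on I ?D v v" for v
      using B_le[of v] by (simp add: D)
    \<comment> \<open>The multiplier \<open>N\<close> makes \<open>g - N d\<close> vanish when
      \<open>S\<close> is \<open>N\<close> times the identity and \<open>B = 0\<close>; in
      \<open>2\<close> below, \<open>N * (1 + \<tau>)\<close> does the same for
      \<open>B = \<tau> S\<close>.\<close>
    ultimately have "0 \<le> qform_on I ?D g g - 2 * N * qform_on I ?D d g + N\<^sup>2 * qform_on I ?D d d"
      by (rule psd_on_square_expand)
    then have 1: "0 \<le> (\<tau> * w - w') - 2 * N * (\<tau> * u - u') + N\<^sup>2 * (\<tau> * p - p')"
      by (simp add: D p_def u_def w_def p'_def u'_def w'_def)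
    have 2: "0 \<le> w' - 2 * (N * (1 + \<tau>)) * u' + (N * (1 + \<tau>))\<^sup>2 * p'"
      unfolding p'_def u'_def w'_def by (rule psd_on_square_expand[OF symB B_nonneg])
    define Q where "Q = N\<^sup>2 * (p + (\<tau> + 2) * p')"
    \<comment> \<open>In the sum of \<open>1\<close> and \<open>2\<close> the terms
      \<open>w'\<close> cancel, and every remaining term carries a factor \<tau>.\<close>
    have "0 \<le> \<tau> * (w - 2 * N * (u + u') + Q)"
      using 1 2 by (simp add: Q_def power2_eq_square algebra_simps)
    then have "0 \<le> w - 2 * N * G + Q"
      using \<tau> False GN by (simp add: zero_le_mult_iff)
    then have "N * G \<le> N * (N * (p + (\<tau> + 2) * p'))"
      using GN by (simp add: Q_def power2_eq_square algebra_simps)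
    then have "G \<le> N * (p + (\<tau> + 2) * p')"
      using \<open>N > 0\<close> by simp
    then have "(1 + 2 * \<tau>) * G \<le> (1 + 2 * \<tau>) * (N * (p + (\<tau> + 2) * p'))"
      using \<tau> by (intro mult_left_mono) auto
    also have "\<dots> = N * ((1 + 2 * \<tau>) * (p + (\<tau> + 2) * p'))"
      by simp
    also have "\<dots> \<le> N * ((1 + \<tau>)\<^sup>2 * (p + 2 * p'))"
    proof (rule mult_left_mono)
      \<comment> \<open>The upper bound on \<open>B\<close> is used a second time here, now at
        \<open>d\<close>.\<close>
      have "(1 + \<tau>)\<^sup>2 * (p + 2 * p') - (1 + 2 * \<tau>) * (p + (\<tau> + 2) * p') = \<tau> * (\<tau> * p - p')"
        by (simp add: power2_eq_square algebra_simps)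
      moreover have "0 \<le> \<tau> * (\<tau> * p - p')"
        using \<tau> pos by simp
      ultimately show "(1 + 2 * \<tau>) * (p + (\<tau> + 2) * p') \<le> (1 + \<tau>)\<^sup>2 * (p + 2 * p')"
        by linarith
    qed (use \<open>N > 0\<close> in simp)
    finally show ?thesis
      by (simp add: mult_ac)
  qed
  then show ?thesis
    by (simp add: G_def p_def p'_def)
qed

section \<open>Solvability and stationarity for quadratic problems\<close>

text \<open>Finite-dimensional Fredholm alternative: the part \<open>w\<close> of \<open>g\<close>
  orthogonal to the range satisfies \<open>|f w|^2 = <w, f (f w)> = 0\<close>, so the kernel
  hypothesis gives \<open>|w|^2 = <w, g> = 0\<close>.\<close>

lemma symmetric_linear_solvable:
  fixes f :: "'a::euclidean_space \<Rightarrow> 'a"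
  assumes "linear f" and sym: "\<And>x y. f x \<bullet> y = x \<bullet> f y"
    and ker: "\<And>w. f w = 0 \<Longrightarrow> w \<bullet> g = 0"
  obtains z where "f z = g"
proof -
  interpret linear f by fact
  have span: "span (range f) = range f"
    using linear_subspace_image[OF \<open>linear f\<close> subspace_UNIV] by (simp add: span_eq_iff)
  obtain a w where a: "a \<in> span (range f)" and w: "\<And>v. v \<in> span (range f) \<Longrightarrow> orthogonal w v"
    and g: "g = a + w"
    using orthogonal_subspace_decomp_exists[of "range f" g] by blast
  have "f w \<bullet> f w = w \<bullet> f (f w)"
    by (rule sym)
  also have "\<dots> = 0"
    using w[of "f (f w)"] by (simp add: span orthogonal_def)
  finally have "f w = 0"
    by simp
  then have "w \<bullet> a + w \<bullet> w = 0"
    using ker[of w] by (simp add: g inner_add_right)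
  then have "w = 0"
    using w[OF a] by (simp add: orthogonal_def)
  then show thesis
    using a g that by (auto simp: span)
qed

text \<open>Fermat's rule in algebraic form: for small \<open>t\<close> of sign opposite to
  \<open>a\<close> the linear term dominates.\<close>

lemma linear_coeff_zero_if_quadratic_nonneg:
  fixes a b :: real
  assumes "\<And>t. 0 \<le> t * a + t\<^sup>2 * b"
  shows "a = 0"
proof -
  \<comment> \<open>Any positive \<open>c\<close> above \<open>b\<close> would do:
    \<open>t = - a / c\<close> then gives a negative value unless \<open>a = 0\<close>.\<close>
  define c where "c = \<bar>b\<bar> + 1"
  have "c > 0" "b < c"
    by (auto simp: c_def)
  have "0 \<le> (- a / c) * a + (- a / c)\<^sup>2 * b"
    by (rule assms)
  also have "\<dots> = a\<^sup>2 * (b - c) / c\<^sup>2"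
    using \<open>c > 0\<close> by (simp add: power2_eq_square field_simps)
  finally have "0 \<le> a\<^sup>2 * (b - c)"
    using \<open>c > 0\<close> by (simp add: zero_le_divide_iff)
  then show ?thesis
    using \<open>b < c\<close> by (auto simp: zero_le_mult_iff)
qed

section \<open>Products with the design matrix as sums and forms over \<open>E\<close>\<close>

lemma matrix_vector_mult_eq_matvec_on:
  fixes X :: "real ^ 'p ^ 'n"
  assumes "\<And>j. j \<notin> E \<Longrightarrow> v $ j = 0"
  shows "(X *v v) $ i = matvec_on E (\<lambda>i j. X $ i $ j) (($) v) i"
  unfolding matrix_vector_mult_def matvec_on_def vec_lambda_beta
  using assms by (intro sum.mono_neutral_right) auto

lemma qform_on_restricted_gram:
  fixes X :: "real ^ 'p ^ 'n"
  shows "qform_on E (restricted_gram X) u v =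
    1 / real CARD('n) *
      (\<Sum>i\<in>UNIV. matvec_on E (\<lambda>i j. X $ i $ j) u i * matvec_on E (\<lambda>i j. X $ i $ j) v i)"
  unfolding restricted_gram_def qform_on_scale_matrix sum_matvec_on_mult_eq_qform_on_gram_on ..

lemma inner_matrix_vector_mult_eq_qform_on:
  fixes X :: "real ^ 'p ^ 'n"
  assumes "\<And>j. j \<notin> E \<Longrightarrow> u $ j = 0" "\<And>j. j \<notin> E \<Longrightarrow> v $ j = 0"
  shows "(X *v u) \<bullet> (X *v v) = real CARD('n) * qform_on E (restricted_gram X) (($) u) (($) v)"
  using assms
  by (simp add: qform_on_restricted_gram inner_vec_def matrix_vector_mult_eq_matvec_on[of E])

lemma inner_matrix_vector_mult_eq_sum_column:
  fixes X :: "real ^ 'p ^ 'n"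
  assumes "\<And>j. j \<notin> E \<Longrightarrow> v $ j = 0"
  shows "r \<bullet> (X *v v) = (\<Sum>j\<in>E. (column j X \<bullet> r) * v $ j)"
proof -
  have "r \<bullet> (X *v v) = (\<Sum>j\<in>UNIV. (column j X \<bullet> r) * v $ j)"
    by (simp add: matrix_mult_sum scalar_mult_eq_scaleR inner_sum_right inner_commute mult.commute)
  also have "\<dots> = (\<Sum>j\<in>E. (column j X \<bullet> r) * v $ j)"
    using assms by (intro sum.mono_neutral_right) auto
  finally show ?thesis .
qed

lemma psd_restricted_gram: "loewner_le_on E (\<lambda>_ _. 0) (restricted_gram X)"
proof -
  have "symmetric_on E (restricted_gram X)"
    using symmetric_on_gram_on[of E UNIV "\<lambda>i j. X $ i $ j"]
    by (simp add: symmetric_on_def restricted_gram_def)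
  moreover have "qform_on E (\<lambda>_ _. 0) v v \<le> qform_on E (restricted_gram X) v v" for v
    by (simp add: qform_on_restricted_gram sum_nonneg)
  ultimately show ?thesis
    by (simp add: loewner_le_on_iff_qform_on symmetric_on_def)
qed

section \<open>The correction and its normal equation\<close>

context
  fixes X :: "real ^ 'p ^ 'n" and y :: "real ^ 'n" and lam :: real
    and q :: nat and A :: "nat \<Rightarrow> 'p \<Rightarrow> real"
begin

private abbreviation (input) "E \<equiv> equicorrelation_set X y lam"
text \<open>\<open>K\<close> is the Hessian of the correction objective in the coordinates of
  \<open>E\<close>, and \<open>g\<close> is minus its gradient at zero.\<close>

private abbreviation (input) "K \<equiv> (\<lambda>j k. restricted_gram X j k + gram_on {..<q} A j k)"
private abbreviation (input) "g \<equiv> (\<lambda>j. 1 / real CARD('n) * (column j X \<bullet> lasso_residual X y lam))"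

text \<open>Exact Taylor expansion along a feasible direction, with the directional derivative at
  \<open>d\<close> in the bracket. It shows both that solutions of the normal equation minimize and
  that minimizers solve it.\<close>

lemma correction_objective_add:
  assumes d: "\<And>j. j \<notin> E \<Longrightarrow> d $ j = 0" and v: "\<And>j. j \<notin> E \<Longrightarrow> v $ j = 0"
  shows "correction_objective X y lam q A (d + v) = correction_objective X y lam q A d +
    (qform_on E K (($) d) (($) v) - (\<Sum>j\<in>E. g j * v $ j)) + 1 / 2 * qform_on E K (($) v) (($) v)"
proof -
  define r where "r = lasso_residual X y lam"
  define N where "N = real CARD('n)"
  have "N > 0"
    by (simp add: N_def)
  let ?S = "qform_on E (restricted_gram X)" and ?B = "qform_on E (gram_on {..<q} A)"
  have penalty: "(L2_set (matvec_on E A w) {..<q})\<^sup>2 = ?B w w" for w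
    by (simp add: L2_set_def sum_nonneg power2_eq_square flip: sum_matvec_on_mult_eq_qform_on_gram_on)
  have "(($) (d + v)) = (\<lambda>j. d $ j + v $ j)"
    by auto
  then have B: "?B (($) (d + v)) (($) (d + v)) =
      ?B (($) d) (($) d) + 2 * ?B (($) d) (($) v) + ?B (($) v) (($) v)"
    using qform_on_commute[OF symmetric_on_gram_on, of E "{..<q}" A "($) v" "($) d"]
    by (simp add: qform_on_add_left qform_on_add_right)
  have square: "(norm (a - b))\<^sup>2 = (norm a)\<^sup>2 - 2 * (a \<bullet> b) + b \<bullet> b" for a b :: "real ^ 'n"
    by (simp add: power2_norm_eq_inner inner_diff inner_commute)
  have "r - X *v (d + v) = (r - X *v d) - X *v v"
    by (simp add: matrix_vector_right_distrib)
  then have "(norm (r - X *v (d + v)))\<^sup>2 =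
      (norm (r - X *v d))\<^sup>2 - 2 * ((r - X *v d) \<bullet> (X *v v)) + (X *v v) \<bullet> (X *v v)"
    by (simp only: square)
  also have "(r - X *v d) \<bullet> (X *v v) = N * ((\<Sum>j\<in>E. g j * v $ j) - ?S (($) d) (($) v))"
  proof -
    have "r \<bullet> (X *v v) = (\<Sum>j\<in>E. (column j X \<bullet> r) * v $ j)"
      using v by (rule inner_matrix_vector_mult_eq_sum_column)
    also have "\<dots> = N * (\<Sum>j\<in>E. g j * v $ j)"
      by (simp add: N_def r_def sum_distrib_left)
    finally show ?thesis
      using inner_matrix_vector_mult_eq_qform_on[of E d v X] d v
      by (simp add: inner_diff_left N_def right_diff_distrib)
  qed
  also have "(X *v v) \<bullet> (X *v v) = N * ?S (($) v) (($) v)"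
    using inner_matrix_vector_mult_eq_qform_on[of E v v X] v by (simp add: N_def)
  finally have S: "(norm (r - X *v (d + v)))\<^sup>2 = (norm (r - X *v d))\<^sup>2 +
      N * (?S (($) v) (($) v) - 2 * ((\<Sum>j\<in>E. g j * v $ j) - ?S (($) d) (($) v)))"
    by (simp add: algebra_simps)
  have obj: "correction_objective X y lam q A w =
      1 / (2 * N) * (norm (r - X *v w))\<^sup>2 + 1 / 2 * ?B (($) w) (($) w)" for w
    by (simp add: correction_objective_def penalty r_def lasso_residual_def N_def)
  show ?thesis
    unfolding obj S B qform_on_add_matrix using \<open>N > 0\<close> by (simp add: field_simps)
qed

text \<open>The kernel condition holds because \<open>K w = 0\<close> forces
  \<open>X_E w = 0\<close>, both summands of \<open>K\<close> being positive semidefinite, while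
  \<open>g\<close> is a multiple of \<open>X_E^T r\<close> and hence orthogonal to such
  \<open>w\<close>.\<close>

lemma normal_equation_solvable:
  obtains z where "\<And>j. j \<notin> E \<Longrightarrow> z $ j = 0" "\<And>v. qform_on E K (($) z) v = (\<Sum>j\<in>E. g j * v j)"
proof -
  \<comment> \<open>\<open>E\<close> is not a type, so the system is padded by zeros to an operator
    on all of \<open>real ^ 'p\<close>.\<close>
  define f :: "real ^ 'p \<Rightarrow> real ^ 'p" where
    "f z = (\<chi> i. if i \<in> E then matvec_on E K (($) z) i else 0)" for z
  define h :: "real ^ 'p" where "h = (\<chi> i. if i \<in> E then g i else 0)"
  have symK: "symmetric_on E K"
    using psd_restricted_gram[of E X] symmetric_on_gram_on[of E "{..<q}" A]
    by (auto simp: loewner_le_on_iff_qform_on symmetric_on_def)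
  have inner_f: "u \<bullet> f v = qform_on E K (($) u) (($) v)" for u v
    by (simp add: f_def inner_vec_def qform_on_def if_distrib[of "(*) _"] sum.If_cases cong: if_cong)
  have "linear f"
  proof (rule linearI)
    show "f (a + b) = f a + f b" for a b
      by (simp add: f_def vec_eq_iff matvec_on_def distrib_left sum.distrib)
    show "f (c *\<^sub>R a) = c *\<^sub>R f a" for c a
      by (simp add: f_def vec_eq_iff matvec_on_def sum_distrib_left mult_ac)
  qed
  moreover have "f u \<bullet> v = u \<bullet> f v" for u v
    using qform_on_commute[OF symK] by (simp add: inner_f inner_commute[of "f u"])
  moreover have "w \<bullet> h = 0" if "f w = 0" for w
  proof -
    \<comment> \<open>\<open>f w = 0\<close> leaves the entries of \<open>w\<close> off
      \<open>E\<close> free; cutting them off lets the product with \<open>X\<close> be read as one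
      over \<open>E\<close>.\<close>
    define u :: "real ^ 'p" where "u = (\<chi> i. if i \<in> E then w $ i else 0)"
    have "0 = qform_on E K (($) w) (($) w)"
      using that inner_f[of w w] by simp
    also have "\<dots> = qform_on E K (($) u) (($) u)"
      by (rule qform_on_cong) (auto simp: u_def)
    finally have "qform_on E (restricted_gram X) (($) u) (($) u) \<le> 0"
      using qform_on_gram_on_nonneg[of E "{..<q}" A "($) u"] by (simp add: qform_on_add_matrix)
    then have "(X *v u) \<bullet> (X *v u) \<le> 0"
      using inner_matrix_vector_mult_eq_qform_on[of E u u X] by (simp add: u_def mult_le_0_iff)
    then have "X *v u = 0"
      by (metis inner_ge_zero inner_eq_zero_iff order_antisym)
    then have "(\<Sum>j\<in>E. (column j X \<bullet> lasso_residual X y lam) * u $ j) = 0"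
      using inner_matrix_vector_mult_eq_sum_column[of E u "lasso_residual X y lam" X]
      by (simp add: u_def)
    then have "(\<Sum>j\<in>E. (column j X \<bullet> lasso_residual X y lam) * w $ j) = 0"
      by (simp add: u_def)
    moreover have "w \<bullet> h = 1 / real CARD('n) * (\<Sum>j\<in>E. (column j X \<bullet> lasso_residual X y lam) * w $ j)"
      by (simp add: h_def inner_vec_def if_distrib[of "(*) _"] sum.If_cases sum_distrib_left mult_ac
          cong: if_cong)
    ultimately show ?thesis
      by simp
  qed
  ultimately obtain z where z: "f z = h"
    using symmetric_linear_solvable[of f h] by blast
  \<comment> \<open>\<open>f\<close> ignores the entries of \<open>z\<close> off \<open>E\<close>,
    so they can be set to zero to obtain a feasible point.\<close>
  define z' :: "real ^ 'p" where "z' = (\<chi> i. if i \<in> E then z $ i else 0)"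
  have "qform_on E K (($) z') v = (\<Sum>j\<in>E. g j * v j)" for v
  proof -
    have "qform_on E K (($) z') v = qform_on E K v (($) z)"
      unfolding qform_on_commute[OF symK, of v] by (rule qform_on_cong) (auto simp: z'_def)
    also have "\<dots> = (\<Sum>j\<in>E. v j * f z $ j)"
      by (simp add: qform_on_def f_def)
    also have "\<dots> = (\<Sum>j\<in>E. g j * v j)"
      by (simp add: z h_def mult.commute)
    finally show ?thesis .
  qed
  then show thesis
    by (intro that[of z']) (simp_all add: z'_def)
qed

text \<open>\<open>arg_min\<close> is a choice operator, so its value is known to be a minimizer
  only once some minimizer is exhibited; \<open>z\<close> is one by convexity. The chosen
  \<open>d\<close> need not be \<open>z\<close> a priori, so its own equation is derived from
  stationarity.\<close>

lemma correction_normal_equation: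
  "qform_on E K (($) (correction X y lam q A)) v = (\<Sum>j\<in>E. g j * v j)"
proof -
  let ?f = "correction_objective X y lam q A" and ?P = "\<lambda>d :: real ^ 'p. \<forall>j. j \<notin> E \<longrightarrow> d $ j = 0"
  define d where "d = correction X y lam q A"
  obtain z where z: "?P z" "\<And>v. qform_on E K (($) z) v = (\<Sum>j\<in>E. g j * v j)"
    using normal_equation_solvable by blast
  have K_nonneg: "0 \<le> qform_on E K v v" for v
    using psd_restricted_gram[of E X] qform_on_gram_on_nonneg[of E "{..<q}" A v]
    by (simp add: loewner_le_on_iff_qform_on qform_on_add_matrix)
  have "is_arg_min ?f ?P z"
  proof -
    have "?f z \<le> ?f b" if "?P b" for b
      using correction_objective_add[of z "b - z"] z that K_nonneg[of "($) (b - z)"] by simp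
    then show ?thesis
      using z(1) by (auto simp: is_arg_min_linorder)
  qed
  then have "is_arg_min ?f ?P d"
    unfolding d_def correction_def arg_min_def by (rule someI)
  then have d: "?P d" and min: "\<And>b. ?P b \<Longrightarrow> ?f d \<le> ?f b"
    by (auto simp: is_arg_min_linorder)
  \<comment> \<open>A feasible direction must vanish off \<open>E\<close>; the discarded entries of
    \<open>v\<close> enter neither side of the equation.\<close>
  define w :: "real ^ 'p" where "w = (\<chi> j. if j \<in> E then v j else 0)"
  have w: "j \<notin> E \<Longrightarrow> w $ j = 0" for j
    by (simp add: w_def)
  have "0 \<le> t * (qform_on E K (($) d) (($) w) - (\<Sum>j\<in>E. g j * w $ j)) +
      t\<^sup>2 * (1 / 2 * qform_on E K (($) w) (($) w))" for t
  proof -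
    have "(($) (t *\<^sub>R w)) = (\<lambda>j. t * w $ j)"
      by auto
    then show ?thesis
      using min[of "d + t *\<^sub>R w"] correction_objective_add[of d "t *\<^sub>R w"] d w
      by (simp add: qform_on_scale_left qform_on_scale_right power2_eq_square
          right_diff_distrib sum_distrib_left mult_ac)
  qed
  then have "qform_on E K (($) d) (($) w) = (\<Sum>j\<in>E. g j * w $ j)"
    using linear_coeff_zero_if_quadratic_nonneg by fastforce
  moreover have "qform_on E K (($) d) (($) w) = qform_on E K (($) d) v"
    by (rule qform_on_cong) (auto simp: w_def)
  ultimately show ?thesis
    by (simp add: d_def w_def)
qed

section \<open>The value of H, its positivity, and the size of the Gram matrix\<close>

text \<open>The linear term of H is \<open>2 <g, d>\<close>, and the normal equation tested against
  \<open>d\<close> itself evaluates \<open><g, d>\<close>.\<close>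

lemma H_val_eq_qform_on:
  assumes "lam > 0"
  shows "H_val X y lam q A =
    qform_on E (restricted_gram X) (($) (correction X y lam q A)) (($) (correction X y lam q A)) +
    2 * qform_on E (gram_on {..<q} A) (($) (correction X y lam q A)) (($) (correction X y lam q A))"
proof -
  let ?d = "($) (correction X y lam q A)"
  have "lam * equicorrelation_signs X y lam j = g j" if "j \<in> E" for j
  proof -
    have "lam = \<bar>g j\<bar>"
      using that by (simp add: equicorrelation_set_def)
    moreover have "equicorrelation_signs X y lam j = sgn (g j)"
      by (simp add: equicorrelation_signs_def sgn_divide)
    ultimately show ?thesis
      by (metis abs_mult_sgn)
  qed
  then have "lam * (\<Sum>j\<in>E. ?d j * equicorrelation_signs X y lam j) = (\<Sum>j\<in>E. g j * ?d j)"
    unfolding sum_distrib_left by (intro sum.cong refl) (metis mult.assoc mult.commute)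
  then have "H_val X y lam q A = 2 * (\<Sum>j\<in>E. g j * ?d j) - qform_on E (restricted_gram X) ?d ?d"
    by (simp add: H_val_def Let_def qform_on_restricted_gram)
  then show ?thesis
    using correction_normal_equation[of ?d] unfolding qform_on_add_matrix by simp
qed

lemma sum_equicorrelation_square:
  "(\<Sum>j\<in>E. (g j)\<^sup>2) = lam\<^sup>2 * real (card E)"
proof -
  have "(g j)\<^sup>2 = lam\<^sup>2" if "j \<in> E" for j
    using that unfolding equicorrelation_set_def by (metis (mono_tags, lifting) mem_Collect_eq power2_abs)
  then show ?thesis
    by simp
qed

lemma H_val_pos:
  assumes "lam > 0" "E \<noteq> {}"
  shows "H_val X y lam q A > 0"
proof (rule ccontr)
  let ?d = "($) (correction X y lam q A)"
  let ?M = "gram_on UNIV (\<lambda>i j. X $ i $ j)" and ?B = "gram_on {..<q} A"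
  \<comment> \<open>Pulling out the scaling makes Cauchy-Schwarz for Gram forms applicable.\<close>
  have S: "qform_on E (restricted_gram X) u v = 1 / real CARD('n) * qform_on E ?M u v" for u v
    unfolding restricted_gram_def by (rule qform_on_scale_matrix)
  assume "\<not> ?thesis"
  then have "qform_on E (restricted_gram X) ?d ?d + 2 * qform_on E ?B ?d ?d \<le> 0"
    using H_val_eq_qform_on[OF \<open>lam > 0\<close>] by simp
  moreover have "0 \<le> qform_on E ?B ?d ?d" "0 \<le> qform_on E (restricted_gram X) ?d ?d"
    by (simp_all add: qform_on_gram_on_nonneg S)
  ultimately have "qform_on E ?B ?d ?d = 0" "qform_on E (restricted_gram X) ?d ?d = 0"
    by linarith+
  then have "qform_on E ?B ?d ?d = 0" "qform_on E ?M ?d ?d = 0"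
    by (simp_all add: S)
  then have "qform_on E ?B ?d g = 0" "qform_on E ?M ?d g = 0"
    using qform_on_gram_on_Cauchy_Schwarz[of E "{..<q}" A ?d g]
      qform_on_gram_on_Cauchy_Schwarz[of E UNIV "\<lambda>i j. X $ i $ j" ?d g] by auto
  \<comment> \<open>The normal equation is tested against \<open>g\<close> itself, where both mixed
    terms have vanished.\<close>
  then have "(\<Sum>j\<in>E. (g j)\<^sup>2) = 0"
    using correction_normal_equation[of g] unfolding power2_eq_square
    by (simp add: qform_on_add_matrix S)
  then show False
    using assms unfolding sum_equicorrelation_square by simp
qed

text \<open>A column indexed by \<open>E\<close> is nonzero, since its scaled correlation with the
  residual has absolute value \<open>lam > 0\<close>. The corresponding diagonal entry, read as the
  form at a unit vector, bounds the norm from below.\<close>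

lemma op_norm_on_restricted_gram_pos:
  assumes "lam > 0" "E \<noteq> {}"
  shows "op_norm_on E E (restricted_gram X) > 0"
proof -
  obtain j where j: "j \<in> E"
    using assms by blast
  then have "column j X \<noteq> 0"
    using assms by (auto simp: equicorrelation_set_def)
  have "0 < 1 / real CARD('n) * (column j X \<bullet> column j X)"
    using \<open>column j X \<noteq> 0\<close> by simp
  also have "\<dots> = restricted_gram X j j"
    by (simp add: restricted_gram_def gram_on_def column_def inner_vec_def)
  also have "\<dots> = qform_on E (restricted_gram X) (\<lambda>k. if k = j then 1 else 0) (\<lambda>k. if k = j then 1 else 0)"
    using j by (simp add: qform_on_def matvec_on_def if_distrib[of "\<lambda>x. x * _"] if_distrib[of "(*) _"]
        cong: if_cong)
  also have "\<dots> \<le> op_norm_on E E (restricted_gram X) * (\<Sum>k\<in>E. (if k = j then 1 else 0)\<^sup>2)"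
    by (rule qform_on_le_op_norm_on) simp
  also have "\<dots> = op_norm_on E E (restricted_gram X)"
    using j by (simp add: if_distrib[of "\<lambda>x. x\<^sup>2"] cong: if_cong)
  finally show ?thesis .
qed

end

theorem proposition5p1:
  fixes X :: "real ^ 'p ^ 'n" and y :: "real ^ 'n" and lam :: real
    and q :: nat and A :: "nat \<Rightarrow> 'p \<Rightarrow> real"
  defines "E \<equiv> equicorrelation_set X y lam"
  assumes "general_position X" and "lam > 0" and "E \<noteq> {}"
  shows "(loewner_le_on E (\<lambda>_ _. 0) (gram_on {..<q} A) \<longrightarrow> H_val X y lam q A > 0) \<and>
    (\<forall>\<tau>\<ge>0.
      loewner_le_on E (\<lambda>_ _. 0) (gram_on {..<q} A) \<and>
      loewner_le_on E (gram_on {..<q} A) (\<lambda>j k. \<tau> * restricted_gram X j k) \<longrightarrow>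
        H_val X y lam q A \<ge>
          lam\<^sup>2 * real (card E) * ((1 + 2 * \<tau>) / (1 + \<tau>)\<^sup>2) *
            (1 / op_norm_on E E (restricted_gram X)) \<and>
        lam\<^sup>2 * real (card E) * ((1 + 2 * \<tau>) / (1 + \<tau>)\<^sup>2) *
          (1 / op_norm_on E E (restricted_gram X)) > 0)"
proof (intro conjI allI impI)
  show "H_val X y lam q A > 0"
    using assms by (intro H_val_pos) auto
next
  fix \<tau> :: real
  assume "\<tau> \<ge> 0"
  define N where "N = op_norm_on E E (restricted_gram X)"
  have N: "N > 0"
    unfolding N_def E_def using assms by (intro op_norm_on_restricted_gram_pos) auto
  have "card E > 0"
    using assms by (simp add: card_gt_0_iff)
  then show "lam\<^sup>2 * real (card E) * ((1 + 2 * \<tau>) / (1 + \<tau>)\<^sup>2) * (1 / N) > 0"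
    using \<open>\<tau> \<ge> 0\<close> \<open>lam > 0\<close> N by (intro mult_pos_pos divide_pos_pos) auto
  assume "loewner_le_on E (\<lambda>_ _. 0) (gram_on {..<q} A) \<and>
    loewner_le_on E (gram_on {..<q} A) (\<lambda>j k. \<tau> * restricted_gram X j k)"
  \<comment> \<open>The abstract bound is applied with the restricted Gram matrix as
    \<open>S\<close>; the squared norm of \<open>g\<close> over \<open>E\<close> is
    \<open>lam\<^sup>2 * real (card E)\<close>.\<close>
  then have "(1 + 2 * \<tau>) * (lam\<^sup>2 * real (card E)) \<le> (1 + \<tau>)\<^sup>2 * N * H_val X y lam q A"
    unfolding H_val_eq_qform_on[OF \<open>lam > 0\<close>] E_def sum_equicorrelation_square[symmetric]
    using N \<open>\<tau> \<ge> 0\<close>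
    by (intro quadratic_solution_lower_bound psd_restricted_gram)
       (auto simp: N_def E_def correction_normal_equation qform_on_le_op_norm_on simp flip: qform_on_add_matrix)
  then show "lam\<^sup>2 * real (card E) * ((1 + 2 * \<tau>) / (1 + \<tau>)\<^sup>2) * (1 / N) \<le> H_val X y lam q A"
    using N \<open>\<tau> \<ge> 0\<close> by (simp add: field_simps)
qed

end
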